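(* For every BPPS instance (with $k$ a valid upper bound on the number of bins and $\mathcal{B}=\{1,\dots,k\}$), an optimal solution to the linear program $\mathrm{LP}_{\mathrm N}$ is $$x_{ib}=\frac1k\ \ (i\in\mathcal I,\ b\in\mathcal B),\qquad y_{cb}=\frac1k\ \ (c\in\mathcal C,\ b\in\mathcal B),\qquad z_b=\frac{\sum_{i\in\mathcal I}w_i+\sum_{c\in\mathcal C}s_c}{k\,d}\ \ (b\in\mathcal B),$$ and its optimal objective function value is $$\zeta(\mathrm{LP}_{\mathrm N})=\frac{r}{d}\Big(\sum_{i\in\mathcal I}w_i+\sum_{c\in\mathcal C}s_c\Big)+\sum_{c\in\mathcal C}f_c.$$
   Context: Bin Packing Problem with Setups (BPPS). An instance consists of: a bin capacity $d\in\mathbb Z_{\ge1}$; items $\mathcal I=\{1,\dots,n\}$ with weights $w_i\in\mathbb Z_{\ge1}$; classes $\mathcal C=\{1,\dots,m\}$ and a partition $\{\mathcal I_1,\dots,\mathcal I_m\}$ of $\mathcal I$ into (nonempty) classes; for each class $c$ a setup weight $s_c\in\mathbb Z_{\ge0}$ and a setup cost $f_c\in\mathbb Z_{\ge0}$; a bin cost $r\in\mathbb Z_{\ge1}$. It is assumed that $w_i+s_c\le d$ for all $c\in\mathcal C$, $i\in\mathcal I_c$, and that the items cannot all be packed in a single bin, i.e. $\sum_{i\in\mathcal I}w_i+\sum_{c\in\mathcal C}s_c>d$. For $S\subseteq\mathcal I$ let $\mathcal C(S)=\{c\in\mathcal C: S\cap\mathcal I_c\neq\emptyset\}$. A packing pattern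 is a subset $S\subseteq\mathcal I$ with $\sum_{i\in S}w_i+\sum_{c\in\mathcal C(S)}s_c\le d$. A feasible solution is a partition $\mathcal S$ of $\mathcal I$ into (nonempty) packing patterns (used bins); its cost is $r|\mathcal S|+\sum_{S\in\mathcal S}\sum_{c\in\mathcal C(S)}f_c$. The problem is to find a feasible solution of minimum cost. Let $k\in\mathbb Z_{\ge1}$ be an upper bound on the number of bins used in any optimal BPPS solution and $\mathcal B=\{1,\dots,k\}$. The linear program $\mathrm{LP}_{\mathrm N}$ is: minimize $\sum_{b\in\mathcal B}\big(r z_b+\sum_{c\in\mathcal C}f_c y_{cb}\big)$ subject to - $\sum_{b\in\mathcal B}x_{ib}=1$ for all $i\in\mathcal I$; - $\sum_{i\in\mathcal I}w_ix_{ib}+\sum_{c\in\mathcal C}s_cy_{cb}\le d\,z_b$ for all $b\in\mathcal B$; - $x_{ib}\le y_{cb}$ for all $c\in\mathcal C$, $i\in\mathcal I_c$, $b\in\mathcal B$; - $0\le x_{ib}\le1$, $0\le y_{cb}\le1$, $0\le z_b\le1$ for all $i\in\mathcal I,c\in\mathcal C,b\in\mathcal B$. (It is the LP relaxation of the integer program with all variables binary.) $\zeta(\mathrm{LP}_{\mathrm N})$ denotes its optimal objective function value. *)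

theory Defs
  imports Complex_Main "HOL-Library.Disjoint_Sets"
begin

record bpps =
  capacity :: nat
  num_items :: nat
  weight :: "nat \<Rightarrow> nat"
  num_classes :: nat
  class_items :: "nat \<Rightarrow> nat set"
  setup_weight :: "nat \<Rightarrow> nat"
  setup_cost :: "nat \<Rightarrow> nat"
  bin_cost :: nat

definition items :: "bpps \<Rightarrow> nat set" where
  "items P = {1..num_items P}"

definition classes :: "bpps \<Rightarrow> nat set" where
  "classes P = {1..num_classes P}"

text \<open>
  The classes form an indexed partition: \<^const>\<open>partition_on\<close> includes nonemptiness of the
  parts, and injectivity excludes the same part being listed under two indices.
\<close>

definition bpps_instance :: "bpps \<Rightarrow> bool" where
  "bpps_instance P \<longleftrightarrow>
     capacity P \<ge> 1 \<and>
     bin_cost P \<ge> 1 \<and>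
     (\<forall>i\<in>items P. weight P i \<ge> 1) \<and>
     partition_on (items P) (class_items P ` classes P) \<and>
     inj_on (class_items P) (classes P) \<and>
     (\<forall>c\<in>classes P. \<forall>i\<in>class_items P c. weight P i + setup_weight P c \<le> capacity P) \<and>
     (\<Sum>i\<in>items P. weight P i) + (\<Sum>c\<in>classes P. setup_weight P c) > capacity P"

definition classes_of :: "bpps \<Rightarrow> nat set \<Rightarrow> nat set" where
  "classes_of P S = {c \<in> classes P. S \<inter> class_items P c \<noteq> {}}"

definition packing_pattern :: "bpps \<Rightarrow> nat set \<Rightarrow> bool" where
  "packing_pattern P S \<longleftrightarrow>
     S \<subseteq> items P \<and>
     (\<Sum>i\<in>S. weight P i) + (\<Sum>c\<in>classes_of P S. setup_weight P c) \<le> capacity P"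

definition bpps_feasible :: "bpps \<Rightarrow> nat set set \<Rightarrow> bool" where
  "bpps_feasible P \<S> \<longleftrightarrow> partition_on (items P) \<S> \<and> (\<forall>S\<in>\<S>. packing_pattern P S)"

definition bpps_cost :: "bpps \<Rightarrow> nat set set \<Rightarrow> nat" where
  "bpps_cost P \<S> = bin_cost P * card \<S> + (\<Sum>S\<in>\<S>. \<Sum>c\<in>classes_of P S. setup_cost P c)"

definition bpps_optimal :: "bpps \<Rightarrow> nat set set \<Rightarrow> bool" where
  "bpps_optimal P \<S> \<longleftrightarrow>
     bpps_feasible P \<S> \<and> (\<forall>\<T>. bpps_feasible P \<T> \<longrightarrow> bpps_cost P \<S> \<le> bpps_cost P \<T>)"

definition valid_bin_bound :: "bpps \<Rightarrow> nat \<Rightarrow> bool" where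
  "valid_bin_bound P k \<longleftrightarrow> k \<ge> 1 \<and> (\<forall>\<S>. bpps_optimal P \<S> \<longrightarrow> card \<S> \<le> k)"

text \<open>
  Points of the linear program with \<open>k\<close> bins are given by functions \<open>x i b\<close>, \<open>y c b\<close>, \<open>z b\<close>,
  of which only the values at items \<open>i\<close>, classes \<open>c\<close> and bins \<open>b \<in> {1..k}\<close> matter.
\<close>

definition lpN_feasible ::
  "bpps \<Rightarrow> nat \<Rightarrow> (nat \<Rightarrow> nat \<Rightarrow> real) \<Rightarrow> (nat \<Rightarrow> nat \<Rightarrow> real) \<Rightarrow> (nat \<Rightarrow> real) \<Rightarrow> bool" where
  "lpN_feasible P k x y z \<longleftrightarrow>
     (\<forall>i\<in>items P. (\<Sum>b\<in>{1..k}. x i b) = 1) \<and>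
     (\<forall>b\<in>{1..k}. (\<Sum>i\<in>items P. real (weight P i) * x i b)
                  + (\<Sum>c\<in>classes P. real (setup_weight P c) * y c b) \<le> real (capacity P) * z b) \<and>
     (\<forall>c\<in>classes P. \<forall>i\<in>class_items P c. \<forall>b\<in>{1..k}. x i b \<le> y c b) \<and>
     (\<forall>i\<in>items P. \<forall>b\<in>{1..k}. 0 \<le> x i b \<and> x i b \<le> 1) \<and>
     (\<forall>c\<in>classes P. \<forall>b\<in>{1..k}. 0 \<le> y c b \<and> y c b \<le> 1) \<and>
     (\<forall>b\<in>{1..k}. 0 \<le> z b \<and> z b \<le> 1)"

definition lpN_objective ::
  "bpps \<Rightarrow> nat \<Rightarrow> (nat \<Rightarrow> nat \<Rightarrow> real) \<Rightarrow> (nat \<Rightarrow> real) \<Rightarrow> real" where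
  "lpN_objective P k y z =
     (\<Sum>b\<in>{1..k}. real (bin_cost P) * z b + (\<Sum>c\<in>classes P. real (setup_cost P c) * y c b))"

definition lpN_optimal ::
  "bpps \<Rightarrow> nat \<Rightarrow> (nat \<Rightarrow> nat \<Rightarrow> real) \<Rightarrow> (nat \<Rightarrow> nat \<Rightarrow> real) \<Rightarrow> (nat \<Rightarrow> real) \<Rightarrow> bool" where
  "lpN_optimal P k x y z \<longleftrightarrow>
     lpN_feasible P k x y z \<and>
     (\<forall>x' y' z'. lpN_feasible P k x' y' z' \<longrightarrow> lpN_objective P k y z \<le> lpN_objective P k y' z')"

text \<open>
  The infimum of a set of reals that is empty or unbounded below is a junk value; for the
  optimal value below neither case arises once an optimal solution exists.
\<close>

definition lpN_value :: "bpps \<Rightarrow> nat \<Rightarrow> real" where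
  "lpN_value P k = Inf {lpN_objective P k y z | x y z. lpN_feasible P k x y z}"

end

theory Submission
  imports Defs
begin

text \<open>
  Write \<open>W\<close> for the total weight of all items and all class setups. Summing the capacity
  constraints over the bins, and using that \<open>y\<^sub>c\<^sub>b\<close> dominates \<open>x\<^sub>i\<^sub>b\<close> for some item \<open>i\<close> of \<open>c\<close>, so that
  every class is set up at least once in total, gives \<open>W \<le> d \<Sum>\<^sub>b z\<^sub>b\<close> and hence the lower bound
  on the objective; the uniform solution attains it. The only nontrivial part of its feasibility is
  \<open>z\<^sub>b \<le> 1\<close>, that is, \<open>W \<le> k d\<close>: packing each item on its own is feasible, so an optimal
  packing exists; it uses at most \<open>k\<close> bins, and its bins together hold at least \<open>W\<close>.
\<close>

lemma finite_items [simp]: "finite (items P)"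
  by (simp add: items_def)

lemma finite_classes [simp]: "finite (classes P)"
  by (simp add: classes_def)

lemma class_items_subset:
  assumes "bpps_instance P" "c \<in> classes P"
  shows "class_items P c \<subseteq> items P"
  using assms by (auto simp: bpps_instance_def partition_on_def)

lemma class_items_nonempty:
  assumes "bpps_instance P" "c \<in> classes P"
  shows "\<exists>i. i \<in> class_items P c"
  using assms by (force simp: bpps_instance_def partition_on_def)

text \<open>Disjointness only makes the two parts equal as sets; injectivity of the indexing then
  identifies the indices.\<close>

lemma class_unique:
  assumes "bpps_instance P" "c \<in> classes P" "c' \<in> classes P"
    and "i \<in> class_items P c" "i \<in> class_items P c'"
  shows "c = c'"
proof -
  have "disjoint (class_items P ` classes P)" and inj: "inj_on (class_items P) (classes P)"
    using assms(1) by (auto simp: bpps_instance_def partition_on_def)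
  then have "class_items P c = class_items P c'"
    using assms(2-) unfolding disjoint_def by blast
  then show ?thesis
    using inj assms by (auto dest: inj_onD)
qed

text \<open>An item alone in a bin incurs exactly one setup, that of its own class, so the
  assumption that weight plus setup weight fits the capacity is just what is required.\<close>

lemma singletons_feasible:
  assumes P: "bpps_instance P"
  shows "bpps_feasible P ((\<lambda>i. {i}) ` items P)"
proof -
  have "packing_pattern P {i}" if i: "i \<in> items P" for i
  proof -
    obtain c where c: "c \<in> classes P" "i \<in> class_items P c"
      using P i unfolding bpps_instance_def partition_on_def by blast
    then have "classes_of P {i} = {c}"
      using class_unique[OF P] by (auto simp: classes_of_def)
    then show ?thesis
      using P i c by (auto simp: packing_pattern_def bpps_instance_def)
  qed
  moreover have "partition_on (items P) ((\<lambda>i. {i}) ` items P)"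
    by (auto simp: partition_on_def disjoint_def)
  ultimately show ?thesis
    by (auto simp: bpps_feasible_def)
qed

text \<open>Costs are natural numbers, so a nonempty set of feasible packings has a cheapest
  member.\<close>

lemma bpps_optimal_exists:
  assumes "bpps_instance P"
  shows "\<exists>\<S>. bpps_optimal P \<S>"
  using ex_has_least_nat[of "bpps_feasible P" _ "bpps_cost P", OF singletons_feasible[OF assms]]
  by (auto simp: bpps_optimal_def)

lemma feasible_total_weight_le:
  assumes P: "bpps_instance P" and S: "bpps_feasible P \<S>"
  shows "(\<Sum>i\<in>items P. weight P i) + (\<Sum>c\<in>classes P. setup_weight P c)
         \<le> card \<S> * capacity P"
proof -
  have part: "partition_on (items P) \<S>"
    and pat: "\<And>S. S \<in> \<S> \<Longrightarrow> packing_pattern P S"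
    using S by (auto simp: bpps_feasible_def)
  have fin: "finite \<S>"
    using part finite_elements[of "items P"] by simp
  have finS: "finite S" if "S \<in> \<S>" for S
    using pat[OF that] finite_subset[OF _ finite_items] by (auto simp: packing_pattern_def)
  have Un: "items P = \<Union>\<S>" and disj: "\<forall>A\<in>\<S>. \<forall>B\<in>\<S>. A \<noteq> B \<longrightarrow> A \<inter> B = {}"
    using part by (auto simp: partition_on_def disjoint_def)
  have w: "(\<Sum>i\<in>items P. weight P i) = (\<Sum>S\<in>\<S>. \<Sum>i\<in>S. weight P i)"
    unfolding Un using sum.Union_disjoint[of \<S> "weight P"] finS disj by simp
  \<comment> \<open>Each class is charged once per bin it meets. Writing the charge as a conditional
    over all of \<open>\<S>\<close> makes the index sets independent, so the two sums can be
    exchanged.\<close>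
  have "(\<Sum>c\<in>classes P. setup_weight P c)
        \<le> (\<Sum>c\<in>classes P. \<Sum>S\<in>\<S>. if S \<inter> class_items P c \<noteq> {} then setup_weight P c else 0)"
  proof (rule sum_mono)
    fix c assume c: "c \<in> classes P"
    then obtain i where i: "i \<in> class_items P c" "i \<in> items P"
      using class_items_nonempty[OF P c] class_items_subset[OF P c] by blast
    then obtain S where S: "S \<in> \<S>" "i \<in> S"
      using Un by auto
    then have "setup_weight P c = (if S \<inter> class_items P c \<noteq> {} then setup_weight P c else 0)"
      using i by auto
    also have "\<dots> \<le> (\<Sum>S\<in>\<S>. if S \<inter> class_items P c \<noteq> {} then setup_weight P c else 0)"
      using S fin by (intro member_le_sum) auto
    finally show "setup_weight P c
        \<le> (\<Sum>S\<in>\<S>. if S \<inter> class_items P c \<noteq> {} then setup_weight P c else 0)" .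
  qed
  also have "\<dots> = (\<Sum>S\<in>\<S>. \<Sum>c\<in>classes_of P S. setup_weight P c)"
    unfolding classes_of_def by (subst sum.swap) (simp add: sum.If_cases Int_def)
  finally have "(\<Sum>i\<in>items P. weight P i) + (\<Sum>c\<in>classes P. setup_weight P c)
      \<le> (\<Sum>S\<in>\<S>. (\<Sum>i\<in>S. weight P i) + (\<Sum>c\<in>classes_of P S. setup_weight P c))"
    by (simp add: w sum.distrib)
  also have "\<dots> \<le> (\<Sum>S\<in>\<S>. capacity P)"
    using pat by (intro sum_mono) (auto simp: packing_pattern_def)
  finally show ?thesis
    by simp
qed

lemma total_weight_le_bins:
  assumes P: "bpps_instance P" and k: "valid_bin_bound P k"
  shows "(\<Sum>i\<in>items P. weight P i) + (\<Sum>c\<in>classes P. setup_weight P c) \<le> k * capacity P"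
proof -
  obtain \<S> where S: "bpps_optimal P \<S>"
    using bpps_optimal_exists[OF P] by blast
  then have "card \<S> \<le> k"
    using k by (auto simp: valid_bin_bound_def)
  then have "card \<S> * capacity P \<le> k * capacity P"
    by simp
  then show ?thesis
    using feasible_total_weight_le[OF P] S by (meson bpps_optimal_def le_trans)
qed

lemma lpN_sum_y_ge_1:
  assumes P: "bpps_instance P" and f: "lpN_feasible P k x y z" and c: "c \<in> classes P"
  shows "1 \<le> (\<Sum>b\<in>{1..k}. y c b)"
proof -
  obtain i where i: "i \<in> class_items P c" "i \<in> items P"
    using class_items_nonempty[OF P c] class_items_subset[OF P c] by blast
  then have "1 = (\<Sum>b\<in>{1..k}. x i b)"
    using f by (simp add: lpN_feasible_def)
  also have "\<dots> \<le> (\<Sum>b\<in>{1..k}. y c b)"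
    using f i c by (intro sum_mono) (auto simp: lpN_feasible_def)
  finally show ?thesis .
qed

text \<open>This is weak duality done by hand: the capacity constraint of each bin gets multiplier
  \<open>r / d\<close>, where \<open>r\<close> is the bin cost and \<open>d\<close> the
  capacity.\<close>

lemma lpN_objective_ge:
  assumes P: "bpps_instance P" and f: "lpN_feasible P k x y z"
  shows "real (bin_cost P) / real (capacity P)
           * ((\<Sum>i\<in>items P. real (weight P i)) + (\<Sum>c\<in>classes P. real (setup_weight P c)))
         + (\<Sum>c\<in>classes P. real (setup_cost P c)) \<le> lpN_objective P k y z"
    (is "_ * ?W + _ \<le> _")
proof -
  have d: "real (capacity P) > 0"
    using P by (simp add: bpps_instance_def)
  \<comment> \<open>Kept general in \<open>g\<close> because it serves twice: for the setup weights
    inside the capacity bound and for the setup costs in the objective.\<close>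
  have y: "(\<Sum>c\<in>classes P. real (g c)) \<le> (\<Sum>c\<in>classes P. real (g c) * (\<Sum>b\<in>{1..k}. y c b))"
    for g :: "nat \<Rightarrow> nat"
    using lpN_sum_y_ge_1[OF P f] by (intro sum_mono) (simp add: mult_le_cancel_left1)
  have x: "(\<Sum>i\<in>items P. real (weight P i) * (\<Sum>b\<in>{1..k}. x i b)) = (\<Sum>i\<in>items P. real (weight P i))"
    using f by (intro sum.cong) (auto simp: lpN_feasible_def)
  have "?W \<le> (\<Sum>i\<in>items P. real (weight P i) * (\<Sum>b\<in>{1..k}. x i b))
             + (\<Sum>c\<in>classes P. real (setup_weight P c) * (\<Sum>b\<in>{1..k}. y c b))"
    using y[of "setup_weight P"] x by linarith
  also have "\<dots> = (\<Sum>b\<in>{1..k}. (\<Sum>i\<in>items P. real (weight P i) * x i b)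
                  + (\<Sum>c\<in>classes P. real (setup_weight P c) * y c b))"
    unfolding sum_distrib_left sum.distrib
    \<comment> \<open>Fixing one index set to the bins lets the exchange of sums rewrite in one
      direction only.\<close>
    by (simp only: sum.swap[of _ "{1..k}"])
  also have "\<dots> \<le> (\<Sum>b\<in>{1..k}. real (capacity P) * z b)"
    using f by (intro sum_mono) (auto simp: lpN_feasible_def)
  finally have "?W / real (capacity P) \<le> (\<Sum>b\<in>{1..k}. z b)"
    unfolding sum_distrib_left[symmetric] using d by (simp add: pos_divide_le_eq mult.commute)
  then have "real (bin_cost P) * (?W / real (capacity P)) \<le> real (bin_cost P) * (\<Sum>b\<in>{1..k}. z b)"
    by (rule mult_left_mono) simp
  moreover have "lpN_objective P k y z = real (bin_cost P) * (\<Sum>b\<in>{1..k}. z b)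
      + (\<Sum>c\<in>classes P. real (setup_cost P c) * (\<Sum>b\<in>{1..k}. y c b))"
    unfolding lpN_objective_def sum_distrib_left sum.distrib
    by (simp only: sum.swap[of _ "{1..k}"])
  ultimately show ?thesis
    using y[of "setup_cost P"] by simp
qed

text \<open>An optimal solution turns the infimum into an attained minimum, which rules out the junk
  value.\<close>

lemma lpN_value_eqI:
  assumes "lpN_optimal P k x y z"
  shows "lpN_value P k = lpN_objective P k y z"
  unfolding lpN_value_def
proof (rule cInf_eq_minimum)
  show "lpN_objective P k y z \<in> {lpN_objective P k y z | x y z. lpN_feasible P k x y z}"
    using assms by (auto simp: lpN_optimal_def)
qed (use assms in \<open>auto simp: lpN_optimal_def\<close>)

theorem proposition1:
  fixes P :: bpps and k :: nat
  assumes "bpps_instance P"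
    and "valid_bin_bound P k"
  shows "lpN_optimal P k
           (\<lambda>i b. 1 / real k)
           (\<lambda>c b. 1 / real k)
           (\<lambda>b. ((\<Sum>i\<in>items P. real (weight P i)) + (\<Sum>c\<in>classes P. real (setup_weight P c)))
                 / (real k * real (capacity P)))
         \<and> lpN_value P k =
             real (bin_cost P) / real (capacity P)
               * ((\<Sum>i\<in>items P. real (weight P i)) + (\<Sum>c\<in>classes P. real (setup_weight P c)))
             + (\<Sum>c\<in>classes P. real (setup_cost P c))"
proof -
  let ?W = "(\<Sum>i\<in>items P. real (weight P i)) + (\<Sum>c\<in>classes P. real (setup_weight P c))"
  let ?x = "\<lambda>(i::nat) (b::nat). 1 / real k"
  let ?z = "\<lambda>b::nat. ?W / (real k * real (capacity P))"
  let ?v = "real (bin_cost P) / real (capacity P) * ?W + (\<Sum>c\<in>classes P. real (setup_cost P c))"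
  have k: "real k > 0" "1 \<le> k" and d: "real (capacity P) > 0"
    using assms by (auto simp: valid_bin_bound_def bpps_instance_def)
  have "real ((\<Sum>i\<in>items P. weight P i) + (\<Sum>c\<in>classes P. setup_weight P c)) \<le> real (k * capacity P)"
    using total_weight_le_bins[OF assms] by (simp only: of_nat_le_iff)
  then have W: "?W \<le> real k * real (capacity P)"
    by simp
  have "0 \<le> ?W"
    by (intro add_nonneg_nonneg sum_nonneg) auto
  \<comment> \<open>The upper bound is where the validity of \<open>k\<close> enters, through
    \<open>W\<close>.\<close>
  then have z: "0 \<le> ?z b" "?z b \<le> 1" for b
    using W k d by (auto simp: divide_le_eq_1 zero_le_divide_iff)
  \<comment> \<open>Every capacity constraint is tight at the uniform solution, so rewriting with
    \<open>cap\<close> makes it trivial.\<close>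
  have cap: "(\<Sum>i\<in>items P. real (weight P i) * (1 / real k))
      + (\<Sum>c\<in>classes P. real (setup_weight P c) * (1 / real k)) = real (capacity P) * ?z b" for b
    using k d by (simp flip: sum_divide_distrib add: field_simps)
  have feas: "lpN_feasible P k ?x ?x ?z"
    unfolding lpN_feasible_def cap using k z by simp
  have obj: "lpN_objective P k ?x ?z = ?v"
    using k d unfolding lpN_objective_def
    by (simp flip: sum_divide_distrib add: field_simps)
  have opt: "lpN_optimal P k ?x ?x ?z"
    unfolding lpN_optimal_def obj using feas lpN_objective_ge[OF assms(1)] by blast
  then show ?thesis
    using lpN_value_eqI[OF opt] obj by simp
qed

end
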